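(* Let $q=2$. Under $G_2$ there are exactly $6$ line orbits, namely: $\mathcal L_1=\{\text{RC-lines}\}$ (size $3$); $\mathcal L_2=\{\text{IA-lines}\}$ (size $1$); $\mathcal L_3=\{\text{U}\Gamma_2\text{-lines}\}$ (size $3$); $\mathcal L_4=\{\text{RA-lines}\}\cup\{\text{IC-lines}\}$ (size $3+1=4$); $\mathcal L_5=\{\text{Tr-lines}\}\cup\{\text{U}\Gamma_1\text{-lines}\}\cup\{\text{Un}\Gamma\text{-lines}\}$ (size $3+3+6=12$); $\mathcal L_6=\{\text{E}\Gamma\text{-lines}\}\cup\{\text{En}\Gamma\text{-lines}\}$ (size $6+6=12$).
   Context: Notation. $\mathbb F_q$ is the field with $q$ elements, $\mathbb F_q^+=\mathbb F_q\cup\{\infty\}$. Points of $\mathrm{PG}(3,q)$ are written $\mathbf P(x_0,x_1,x_2,x_3)$ with $x$ a nonzero row vector up to scalars; $\boldsymbol\pi(c_0,c_1,c_2,c_3)$ is the plane $c_0x_0+c_1x_1+c_2x_2+c_3x_3=0$. Put $P(t)=\mathbf P(t^3,t^2,t,1)$ for $t\in\mathbb F_q$, $P(\infty)=\mathbf P(1,0,0,0)$, and $\mathscr C=\{P(t):t\in\mathbb F_q^+\}$ (the twisted cubic). The osculating planes are $\pi_{\rm osc}(t)=\boldsymbol\pi(1,-3t,3t^2,-t^3)$ ($t\in\mathbb F_q$) and $\pi_{\rm osc}(\infty)=\boldsymbol\pi(0,0,0,1)$; these $q+1$ planes are called $\Gamma$-planes. The tangent at $P(t)$, $t\in\mathbb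 F_q$, is the line through $P(t)$ and $\mathbf P(3t^2,2t,1,0)$; the tangent at $P(\infty)$ is the line through $\mathbf P(1,0,0,0)$ and $\mathbf P(0,1,0,0)$. A real chord is a line through two distinct points of $\mathscr C$; a real axis is the intersection of two distinct $\Gamma$-planes. For $\alpha\in\mathbb F_{q^2}\setminus\mathbb F_q$, the line of $\mathrm{PG}(3,q^2)$ through $P(\alpha),P(\alpha^q)$ (resp. the intersection of the planes $\pi_{\rm osc}(\alpha),\pi_{\rm osc}(\alpha^q)$, given by the same formulas over $\mathbb F_{q^2}$) is defined over $\mathbb F_q$, and the corresponding line of $\mathrm{PG}(3,q)$ is an imaginary chord (resp. imaginary axis). A unisecant is a line meeting $\mathscr C$ in exactly one point; an external line is a line disjoint from $\mathscr C$. $G_q$ is the group of all projectivities of $\mathrm{PG}(3,q)$ mapping $\mathscr C$ onto itself. Line types (for $q\not\equiv0\pmod 3$): RC = real chord; Tr = tangent; IC = imaginary chord; RA = real axis; IA = imaginary axis; U$\Gamma$ = unisecant which is not a tangent and is contained in some $\Gamma$-plane; Un$\Gamma$ = unisecant contained in no $\Gamma$-plane; E$\Gamma$ = external line contained in exactly one $\Gamma$-plane; En$\Gamma$ = external line contained in no $\Gamma$-plane that is neither an imaginary chord nor an imaginary axis. For $q=2$: $\mathscr C$ lies in the plane $x_1=x_2$; U$\Gamma_2$-lines are the U$\Gamma$-lines contained in the plane $x_1=x_2$, and U$\Gamma_1$-lines are the remaining U$\Gamma$-lines. *)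

theory Defs
  imports "HOL-Analysis.Analysis" "HOL-Library.Z2"
begin

section \<open>The field with four elements\<close>

text \<open>GF4 = {0, 1, w, w2} with w2 = w + 1, w * w = w2.\<close>

datatype gf4 = G0 | G1 | GW | GW2

fun gf4_add :: "gf4 \<Rightarrow> gf4 \<Rightarrow> gf4" where
  "gf4_add G0 y = y"
| "gf4_add x G0 = x"
| "gf4_add G1 G1 = G0" | "gf4_add G1 GW = GW2" | "gf4_add G1 GW2 = GW"
| "gf4_add GW G1 = GW2" | "gf4_add GW GW = G0" | "gf4_add GW GW2 = G1"
| "gf4_add GW2 G1 = GW" | "gf4_add GW2 GW = G1" | "gf4_add GW2 GW2 = G0"

fun gf4_mul :: "gf4 \<Rightarrow> gf4 \<Rightarrow> gf4" where
  "gf4_mul G0 y = G0"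
| "gf4_mul x G0 = G0"
| "gf4_mul G1 y = y"
| "gf4_mul x G1 = x"
| "gf4_mul GW GW = GW2" | "gf4_mul GW GW2 = G1"
| "gf4_mul GW2 GW = G1" | "gf4_mul GW2 GW2 = GW"

fun gf4_inv :: "gf4 \<Rightarrow> gf4" where
  "gf4_inv G0 = G0" | "gf4_inv G1 = G1" | "gf4_inv GW = GW2" | "gf4_inv GW2 = GW"

instantiation gf4 :: field
begin
definition "0 = G0"
definition "1 = G1"
definition "x + y = gf4_add x y"
definition "x * y = gf4_mul x y"
definition "- x = (x :: gf4)"
definition "x - y = gf4_add x y"
definition "inverse x = gf4_inv x"
definition "x div y = gf4_mul x (gf4_inv y)"
instance
  apply standard
  unfolding zero_gf4_def one_gf4_def plus_gf4_def times_gf4_def uminus_gf4_def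
    minus_gf4_def inverse_gf4_def divide_gf4_def
  subgoal for a b c by (cases a; cases b; cases c; simp)
  subgoal for a b by (cases a; cases b; simp)
  subgoal for a by (cases a; simp)
  subgoal for a b c by (cases a; cases b; cases c; simp)
  subgoal for a b by (cases a; cases b; simp)
  subgoal for a by (cases a; simp)
  subgoal for a by (cases a; simp)
  subgoal for a b by (cases a; cases b; simp)
  subgoal for a b c by (cases a; cases b; cases c; simp)
  subgoal by simp
  subgoal for a by (cases a; simp)
  subgoal for a b by (cases a; cases b; simp)
  subgoal by simp
  done
end

text \<open>The embedding of GF(2) (the library field \<open>bit\<close>) into GF(4).\<close>

definition emb24 :: "bit \<Rightarrow> gf4" where
  "emb24 b = (if b = 0 then 0 else 1)"

definition emb24_vec :: "bit ^ 4 \<Rightarrow> gf4 ^ 4" where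
  "emb24_vec x = (\<chi> i. emb24 (x $ i))"

section \<open>Projective 3-space PG(3,F) over a field F\<close>

definition vec4 :: "'a \<Rightarrow> 'a \<Rightarrow> 'a \<Rightarrow> 'a \<Rightarrow> 'a ^ 4" where
  "vec4 a b c d = (\<chi> i. if i = 0 then a else if i = 1 then b else if i = 2 then c else d)"

definition dot4 :: "'a::comm_ring_1 ^ 4 \<Rightarrow> 'a ^ 4 \<Rightarrow> 'a" where
  "dot4 c x = (\<Sum>i\<in>UNIV. c $ i * x $ i)"

text \<open>A point P(x) of PG(3,F): the class of a nonzero vector up to nonzero scalars.\<close>

definition proj_point :: "'a::field ^ 4 \<Rightarrow> ('a ^ 4) set" where
  "proj_point x = {c *s x | c. c \<noteq> 0}"

definition pg_points :: "('a::field ^ 4) set set" where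
  "pg_points = {proj_point x | x. x \<noteq> 0}"

definition lin_indep2 :: "'a::field ^ 4 \<Rightarrow> 'a ^ 4 \<Rightarrow> bool" where
  "lin_indep2 x y \<longleftrightarrow> (\<forall>a b. a *s x + b *s y = 0 \<longrightarrow> a = 0 \<and> b = 0)"

text \<open>The line through P(x) and P(y) (x, y linearly independent), as a set of points.\<close>

definition line_through :: "'a::field ^ 4 \<Rightarrow> 'a ^ 4 \<Rightarrow> ('a ^ 4) set set" where
  "line_through x y = {proj_point (a *s x + b *s y) | a b. a *s x + b *s y \<noteq> 0}"

definition pg_lines :: "('a::field ^ 4) set set set" where
  "pg_lines = {line_through x y | x y. lin_indep2 x y}"

text \<open>The plane pi(c0,c1,c2,c3), as a set of points.\<close>

definition plane :: "'a::field ^ 4 \<Rightarrow> ('a ^ 4) set set" where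
  "plane c = {proj_point x | x. x \<noteq> 0 \<and> dot4 c x = 0}"

section \<open>The twisted cubic, osculating planes, tangents\<close>

text \<open>Parameters in F^+ = F \<union> {\<infinity>} are modelled by \<open>'a option\<close>, with \<open>None\<close> = \<infinity>.\<close>

fun tc_vec :: "'a::field option \<Rightarrow> 'a ^ 4" where
  "tc_vec (Some t) = vec4 (t ^ 3) (t ^ 2) t 1"
| "tc_vec None = vec4 1 0 0 0"

definition tcubic :: "('a::field ^ 4) set set" where
  "tcubic = {proj_point (tc_vec t) | t. True}"

fun osc_coef :: "'a::field option \<Rightarrow> 'a ^ 4" where
  "osc_coef (Some t) = vec4 1 (- 3 * t) (3 * t ^ 2) (- (t ^ 3))"
| "osc_coef None = vec4 0 0 0 1"

definition gamma_planes :: "('a::field ^ 4) set set set" where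
  "gamma_planes = {plane (osc_coef t) | t. True}"

fun tangent :: "'a::field option \<Rightarrow> ('a ^ 4) set set" where
  "tangent (Some t) = line_through (tc_vec (Some t)) (vec4 (3 * t ^ 2) (2 * t) 1 0)"
| "tangent None = line_through (vec4 1 0 0 0) (vec4 0 1 0 0)"

section \<open>Line types\<close>

definition is_RC :: "('a::field ^ 4) set set \<Rightarrow> bool" where
  "is_RC L \<longleftrightarrow> L \<in> pg_lines \<and>
     (\<exists>P\<in>tcubic. \<exists>Q\<in>tcubic. P \<noteq> Q \<and> P \<in> L \<and> Q \<in> L)"

definition is_Tr :: "('a::field ^ 4) set set \<Rightarrow> bool" where
  "is_Tr L \<longleftrightarrow> (\<exists>t. L = tangent t)"

definition is_RA :: "('a::field ^ 4) set set \<Rightarrow> bool" where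
  "is_RA L \<longleftrightarrow> L \<in> pg_lines \<and>
     (\<exists>\<pi>1\<in>gamma_planes. \<exists>\<pi>2\<in>gamma_planes. \<pi>1 \<noteq> \<pi>2 \<and> L = \<pi>1 \<inter> \<pi>2)"

definition unisecant :: "('a::field ^ 4) set set \<Rightarrow> bool" where
  "unisecant L \<longleftrightarrow> L \<in> pg_lines \<and> card (L \<inter> tcubic) = 1"

definition external_line :: "('a::field ^ 4) set set \<Rightarrow> bool" where
  "external_line L \<longleftrightarrow> L \<in> pg_lines \<and> L \<inter> tcubic = {}"

definition in_gamma_plane :: "('a::field ^ 4) set set \<Rightarrow> bool" where
  "in_gamma_plane L \<longleftrightarrow> (\<exists>\<pi>\<in>gamma_planes. L \<subseteq> \<pi>)"

definition is_UG :: "('a::field ^ 4) set set \<Rightarrow> bool" where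
  "is_UG L \<longleftrightarrow> unisecant L \<and> \<not> is_Tr L \<and> in_gamma_plane L"

definition is_UnG :: "('a::field ^ 4) set set \<Rightarrow> bool" where
  "is_UnG L \<longleftrightarrow> unisecant L \<and> \<not> in_gamma_plane L"

definition is_EG :: "('a::field ^ 4) set set \<Rightarrow> bool" where
  "is_EG L \<longleftrightarrow> external_line L \<and> card {\<pi>\<in>gamma_planes. L \<subseteq> \<pi>} = 1"

text \<open>Imaginary chords and axes, for q = 2, via GF(4) = GF(2^2).  For alpha in
  GF(4) \ GF(2) we have alpha^q = alpha^2.  A line L of PG(3,2) is the line
  corresponding to a line of PG(3,4) defined over GF(2) iff every point of L
  (embedded into PG(3,4)) lies on that line.\<close>

definition span2 :: "'a::field ^ 4 \<Rightarrow> 'a ^ 4 \<Rightarrow> ('a ^ 4) set" where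
  "span2 u v = {a *s u + b *s v | a b. True}"

definition is_IC2 :: "(bit ^ 4) set set \<Rightarrow> bool" where
  "is_IC2 L \<longleftrightarrow> L \<in> pg_lines \<and>
     (\<exists>\<alpha>::gf4. \<alpha> \<notin> range emb24 \<and>
        (\<forall>P\<in>L. \<forall>x\<in>P. emb24_vec x \<in> span2 (tc_vec (Some \<alpha>)) (tc_vec (Some (\<alpha> ^ 2)))))"

definition is_IA2 :: "(bit ^ 4) set set \<Rightarrow> bool" where
  "is_IA2 L \<longleftrightarrow> L \<in> pg_lines \<and>
     (\<exists>\<alpha>::gf4. \<alpha> \<notin> range emb24 \<and>
        (\<forall>P\<in>L. \<forall>x\<in>P. dot4 (osc_coef (Some \<alpha>)) (emb24_vec x) = 0 \<and>
                        dot4 (osc_coef (Some (\<alpha> ^ 2))) (emb24_vec x) = 0))"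

definition is_EnG2 :: "(bit ^ 4) set set \<Rightarrow> bool" where
  "is_EnG2 L \<longleftrightarrow> external_line L \<and> \<not> in_gamma_plane L \<and> \<not> is_IC2 L \<and> \<not> is_IA2 L"

text \<open>For q = 2 the cubic lies in the plane x1 = x2.\<close>

definition plane_x1_x2 :: "('a::field ^ 4) set set" where
  "plane_x1_x2 = plane (vec4 0 1 (-1) 0)"

definition is_UG2 :: "('a::field ^ 4) set set \<Rightarrow> bool" where
  "is_UG2 L \<longleftrightarrow> is_UG L \<and> L \<subseteq> plane_x1_x2"

definition is_UG1 :: "('a::field ^ 4) set set \<Rightarrow> bool" where
  "is_UG1 L \<longleftrightarrow> is_UG L \<and> \<not> L \<subseteq> plane_x1_x2"

section \<open>The group G_q and line orbits\<close>

text \<open>Projectivity induced by an invertible matrix A, acting on points and lines.\<close>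

definition pmap :: "'a::field ^ 4 ^ 4 \<Rightarrow> ('a ^ 4) set \<Rightarrow> ('a ^ 4) set" where
  "pmap A P = (\<lambda>x. A *v x) ` P"

definition lmap :: "'a::field ^ 4 ^ 4 \<Rightarrow> ('a ^ 4) set set \<Rightarrow> ('a ^ 4) set set" where
  "lmap A L = pmap A ` L"

definition Gq :: "('a::field ^ 4 ^ 4) set" where
  "Gq = {A. invertible A \<and> pmap A ` tcubic = tcubic}"

definition line_orbit :: "('a::field ^ 4) set set \<Rightarrow> ('a ^ 4) set set set" where
  "line_orbit L = {lmap A L | A. A \<in> Gq}"

definition line_orbits :: "('a::field ^ 4) set set set set" where
  "line_orbits = line_orbit ` pg_lines"

end

theory Submission
  imports Defs
begin

text \<open>
  Over GF(2) a point of PG(3,2) is a nonzero vector and the line through x and y is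
  {x, y, x + y}, so the 35 lines can be listed and each line type of the theorem decided line by
  line. The cubic consists of the three points C = {P(\<infinity>), P(0), P(1)}. They span the plane
  x1 = x2, which also contains the third points D of the three real chords and the point c common
  to the osculating planes. An element of G_2 permutes C, hence permutes D, fixes c and preserves
  the plane, so the profile (|L \<inter> C|, |L \<inter> D|, c \<in> L) of a line L is invariant; it takes six
  values. Conversely G_2 is transitive on lines of equal profile: the projectivities induced by
  t \<mapsto> 1/t and t \<mapsto> t + 1 permute C transitively, and the transvections x \<mapsto> x + (x1 + x2) t with t
  in the plane fix the plane pointwise and move a line meeting it in a single point p to any
  other such line through p. So the six profile classes are the line orbits.
\<close>

section \<open>Coordinates\<close>

lemma four_eq_zero: "(4 :: 4) = 0"
  by simp

lemma all_index_4: "(\<forall>i::4. P i) \<longleftrightarrow> P 0 \<and> P 1 \<and> P 2 \<and> P 3"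
  unfolding forall_4 four_eq_zero by auto

lemma sum_UNIV_4: "sum f (UNIV :: 4 set) = f 0 + f 1 + f 2 + f 3"
  unfolding sum_4 four_eq_zero by (simp add: ac_simps)

lemma vec4_nth [simp]:
  "vec4 a b c d $ 0 = a" "vec4 a b c d $ 1 = b" "vec4 a b c d $ 2 = c" "vec4 a b c d $ 3 = d"
  by (simp_all add: vec4_def)

lemma vec4_eta: "x = vec4 (x $ 0) (x $ 1) (x $ 2) (x $ 3)"
  by (simp add: vec_eq_iff all_index_4)

lemma vec4_eq_iff [simp]:
  "vec4 a b c d = vec4 a' b' c' d' \<longleftrightarrow> a = a' \<and> b = b' \<and> c = c' \<and> d = d'"
  by (auto simp: vec_eq_iff all_index_4)

lemma vec4_add [simp]: "vec4 a b c d + vec4 a' b' c' d' = vec4 (a + a') (b + b') (c + c') (d + d')"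
  by (simp add: vec_eq_iff all_index_4)

lemma vec4_scalar_mult [simp]: "k *s vec4 a b c d = vec4 (k * a) (k * b) (k * c) (k * d)"
  by (simp add: vec_eq_iff all_index_4)

lemma zero_vec4: "0 = vec4 0 0 0 0"
  by (simp add: vec_eq_iff all_index_4)

lemma dot4_vec4 [simp]: "dot4 (vec4 a b c d) (vec4 a' b' c' d') = a * a' + b * b' + c * c' + d * d'"
  by (simp add: dot4_def sum_UNIV_4)

lemma dot4_add: "dot4 w (x + y) = dot4 w x + dot4 w y"
  by (simp add: dot4_def sum_UNIV_4 algebra_simps)

lemma dot4_scalar_mult: "dot4 w (c *s y) = c * dot4 w y"
  by (simp add: dot4_def sum_UNIV_4 algebra_simps)

lemma vec4_matrix_vector_mult [simp]:
  "vec4 r0 r1 r2 r3 *v x = vec4 (dot4 r0 x) (dot4 r1 x) (dot4 r2 x) (dot4 r3 x)"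
  by (simp add: vec_eq_iff all_index_4 matrix_vector_mult_def dot4_def)

lemma vec4_vector_matrix_mult:
  "vec4 a b c d v* vec4 r0 r1 r2 r3 = a *s r0 + b *s r1 + c *s r2 + d *s r3"
  by (simp add: vec_eq_iff all_index_4 vector_matrix_mult_def sum_UNIV_4 mult.commute)

lemma vec4_matrix_mult:
  "vec4 r0 r1 r2 r3 ** B = vec4 (r0 v* B) (r1 v* B) (r2 v* B) (r3 v* B)"
  by (simp add: vec_eq_iff all_index_4 matrix_matrix_mult_def vector_matrix_mult_def mult.commute)

lemma mat_1_vec4: "mat 1 = vec4 (vec4 1 0 0 0) (vec4 0 1 0 0) (vec4 0 0 1 0) (vec4 0 0 0 1)"
  by (simp add: vec_eq_iff all_index_4 mat_def)

lemma image_matrix_mult: "(*v) (A ** B) ` S = (*v) A ` (*v) B ` S"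
  by (simp add: image_image matrix_vector_mul_assoc)

lemma bit_eq_0_or_1: "(b :: bit) = 0 \<or> b = 1"
  by (cases b) simp_all

lemma all_bit: "(\<forall>b :: bit. P b) \<longleftrightarrow> P 0 \<and> P 1"
  by (metis bit_eq_0_or_1)

lemma ex_bit: "(\<exists>b :: bit. P b) \<longleftrightarrow> P 0 \<or> P 1"
  by (metis bit_eq_0_or_1)

lemma all_bit4: "(\<forall>x :: bit ^ 4. P x) \<longleftrightarrow> (\<forall>a b c d. P (vec4 a b c d))"
  by (metis vec4_eta)

lemma bit4_cases:
  fixes x :: "bit ^ 4"
  obtains
    "x = vec4 0 0 0 0" | "x = vec4 0 0 0 1" | "x = vec4 0 0 1 0" | "x = vec4 0 0 1 1" |
    "x = vec4 0 1 0 0" | "x = vec4 0 1 0 1" | "x = vec4 0 1 1 0" | "x = vec4 0 1 1 1" |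
    "x = vec4 1 0 0 0" | "x = vec4 1 0 0 1" | "x = vec4 1 0 1 0" | "x = vec4 1 0 1 1" |
    "x = vec4 1 1 0 0" | "x = vec4 1 1 0 1" | "x = vec4 1 1 1 0" | "x = vec4 1 1 1 1"
proof -
  have "x = vec4 (x $ 0) (x $ 1) (x $ 2) (x $ 3)"
    by (rule vec4_eta)
  then show thesis
    using that bit_eq_0_or_1[of "x $ 0"] bit_eq_0_or_1[of "x $ 1"]
      bit_eq_0_or_1[of "x $ 2"] bit_eq_0_or_1[of "x $ 3"]
    by auto
qed

lemma bit4_add_self [simp]: "(x :: bit ^ 4) + x = 0"
  by (cases x rule: bit4_cases) (simp_all add: zero_vec4)

lemma bit4_add_eq_0_iff: "(x :: bit ^ 4) + y = 0 \<longleftrightarrow> x = y"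
  by (metis add_right_cancel bit4_add_self)

section \<open>Points and lines of PG(3,2)\<close>

lemma proj_point_bit: "proj_point (x :: bit ^ 4) = {x}"
proof -
  have "c = 1" if "c \<noteq> 0" for c :: bit
    using that by simp
  then show ?thesis
    by (auto simp: proj_point_def intro: exI[of _ 1])
qed

lemma inj_proj_point_bit: "inj (proj_point :: bit ^ 4 \<Rightarrow> _)"
  by (rule injI) (simp add: proj_point_bit)

lemma proj_point_eq_iff [simp]: "proj_point x = proj_point y \<longleftrightarrow> x = (y :: bit ^ 4)"
  by (rule inj_eq[OF inj_proj_point_bit])

lemma proj_point_image_eq_iff [simp]:
  "proj_point ` V = proj_point ` W \<longleftrightarrow> V = (W :: (bit ^ 4) set)"
  by (rule inj_image_eq_iff[OF inj_proj_point_bit])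

lemma inj_proj_point_image: "inj ((`) (proj_point :: bit ^ 4 \<Rightarrow> _))"
  by (rule injI) simp

lemma proj_point_image_subset_iff [simp]:
  "proj_point ` V \<subseteq> proj_point ` W \<longleftrightarrow> V \<subseteq> (W :: (bit ^ 4) set)"
  by (rule inj_image_subset_iff[OF inj_proj_point_bit])

lemma proj_point_image_mem_iff [simp]: "proj_point x \<in> proj_point ` V \<longleftrightarrow> (x :: bit ^ 4) \<in> V"
  by (rule inj_image_mem_iff[OF inj_proj_point_bit])

lemma proj_point_image_Int:
  "proj_point ` V \<inter> proj_point ` W = proj_point ` (V \<inter> (W :: (bit ^ 4) set))"
  by (rule image_Int[OF inj_proj_point_bit, symmetric])

lemma lin_indep2_bit: "lin_indep2 (x :: bit ^ 4) y \<longleftrightarrow> x \<noteq> 0 \<and> y \<noteq> 0 \<and> x \<noteq> y"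
  unfolding lin_indep2_def all_bit by (auto simp: bit4_add_eq_0_iff)

definition line_vecs :: "'a::plus \<Rightarrow> 'a \<Rightarrow> 'a set" where
  "line_vecs x y = {x, y, x + y}"

lemma image_line_vecs: "(*v) A ` line_vecs x y = line_vecs (A *v x) (A *v y)"
  by (simp add: line_vecs_def matrix_vector_right_distrib)

lemma line_through_bit:
  assumes "lin_indep2 (x :: bit ^ 4) y"
  shows "line_through x y = proj_point ` line_vecs x y"
  using assms unfolding line_through_def line_vecs_def lin_indep2_bit
  by (auto simp: ex_bit proj_point_bit bit4_add_eq_0_iff eq_commute[of "x + y" 0])

lemma line_vecs_eq:
  fixes a b x y :: "bit ^ 4"
  assumes "x \<in> line_vecs a b" "y \<in> line_vecs a b" "x \<noteq> y"
  shows "line_vecs a b = line_vecs x y"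
proof -
  have sums: "a + (a + b) = b" "a + b + a = b" "b + (a + b) = a" "a + b + b = a" "b + a = a + b"
    by (simp_all add: add.commute add.left_commute flip: add.assoc)
  show ?thesis
    using assms unfolding line_vecs_def
    by (elim insertE emptyE) (simp_all add: sums insert_commute)
qed

definition real_chord_lines :: "(bit ^ 4) set list" where
  "real_chord_lines =
    [line_vecs (vec4 1 0 0 0) (vec4 0 0 0 1),
     line_vecs (vec4 1 0 0 0) (vec4 1 1 1 1),
     line_vecs (vec4 0 0 0 1) (vec4 1 1 1 1)]"

definition imag_axis_lines :: "(bit ^ 4) set list" where
  "imag_axis_lines =
    [line_vecs (vec4 1 0 0 1) (vec4 0 1 1 1)]"

definition ug2_lines :: "(bit ^ 4) set list" where
  "ug2_lines =
    [line_vecs (vec4 1 0 0 0) (vec4 0 1 1 0),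
     line_vecs (vec4 0 0 0 1) (vec4 0 1 1 0),
     line_vecs (vec4 1 1 1 1) (vec4 0 1 1 0)]"

definition real_axis_lines :: "(bit ^ 4) set list" where
  "real_axis_lines =
    [line_vecs (vec4 0 1 1 0) (vec4 0 1 0 0),
     line_vecs (vec4 0 1 1 0) (vec4 0 1 0 1),
     line_vecs (vec4 0 1 1 0) (vec4 1 1 0 0)]"

definition imag_chord_lines :: "(bit ^ 4) set list" where
  "imag_chord_lines =
    [line_vecs (vec4 0 1 1 0) (vec4 1 1 0 1)]"

definition tangent_lines :: "(bit ^ 4) set list" where
  "tangent_lines =
    [line_vecs (vec4 1 0 0 0) (vec4 0 1 0 0),
     line_vecs (vec4 0 0 0 1) (vec4 0 0 1 0),
     line_vecs (vec4 1 1 1 1) (vec4 1 0 1 0)]"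

definition ug1_lines :: "(bit ^ 4) set list" where
  "ug1_lines =
    [line_vecs (vec4 1 0 0 0) (vec4 0 0 1 0),
     line_vecs (vec4 0 0 0 1) (vec4 0 1 0 0),
     line_vecs (vec4 1 1 1 1) (vec4 0 0 1 1)]"

definition ung_lines :: "(bit ^ 4) set list" where
  "ung_lines =
    [line_vecs (vec4 1 0 0 0) (vec4 0 0 1 1),
     line_vecs (vec4 1 0 0 0) (vec4 0 1 0 1),
     line_vecs (vec4 0 0 0 1) (vec4 1 0 1 0),
     line_vecs (vec4 0 0 0 1) (vec4 1 1 0 0),
     line_vecs (vec4 1 1 1 1) (vec4 0 0 1 0),
     line_vecs (vec4 1 1 1 1) (vec4 0 1 0 0)]"

definition eg_lines :: "(bit ^ 4) set list" where
  "eg_lines =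
    [line_vecs (vec4 1 0 0 1) (vec4 0 0 1 1),
     line_vecs (vec4 1 0 0 1) (vec4 0 1 0 1),
     line_vecs (vec4 0 1 1 1) (vec4 0 1 0 0),
     line_vecs (vec4 0 1 1 1) (vec4 0 1 0 1),
     line_vecs (vec4 1 1 1 0) (vec4 0 1 0 0),
     line_vecs (vec4 1 1 1 0) (vec4 1 1 0 0)]"

definition eng_lines :: "(bit ^ 4) set list" where
  "eng_lines =
    [line_vecs (vec4 1 0 0 1) (vec4 0 0 1 0),
     line_vecs (vec4 1 0 0 1) (vec4 0 1 0 0),
     line_vecs (vec4 0 1 1 1) (vec4 1 1 0 0),
     line_vecs (vec4 0 1 1 1) (vec4 1 1 0 1),
     line_vecs (vec4 1 1 1 0) (vec4 0 1 0 1),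
     line_vecs (vec4 1 1 1 0) (vec4 1 1 0 1)]"

text \<open>
  Each line is written \<open>line_vecs p v\<close> with p on the plane x1 = x2 spanned by the cubic;
  the brackets group the lines into the six orbits.
\<close>

definition all_lines :: "(bit ^ 4) set list" where
  "all_lines = real_chord_lines @ imag_axis_lines @ ug2_lines @ (real_axis_lines @ imag_chord_lines)
     @ (tangent_lines @ ug1_lines @ ung_lines) @ (eg_lines @ eng_lines)"

lemmas line_lists_def = real_chord_lines_def imag_axis_lines_def ug2_lines_def real_axis_lines_def
  imag_chord_lines_def tangent_lines_def ug1_lines_def ung_lines_def eg_lines_def eng_lines_def

lemma distinct_all_lines: "distinct all_lines"
  by (simp add: all_lines_def line_lists_def line_vecs_def set_eq_subset)

text \<open>
  Stated for the lines through x, which the simplifier filters out first: searching all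
  35 lines for each of the 256 pairs (x, y) is much slower.
\<close>

lemma all_lines_cover:
  fixes x y :: "bit ^ 4"
  assumes "x \<noteq> 0" "y \<noteq> 0" "x \<noteq> y"
  shows "\<exists>V\<in>set (filter ((\<in>) x) all_lines). y \<in> V"
  using assms unfolding all_lines_def line_lists_def line_vecs_def
  by (cases x rule: bit4_cases; simp add: zero_vec4; cases y rule: bit4_cases; simp)

lemma all_lines_are_lines: "\<forall>V\<in>set all_lines. \<exists>a b. lin_indep2 a b \<and> V = line_vecs a b"
proof -
  have line: "lin_indep2 a b \<Longrightarrow> \<exists>x y. lin_indep2 x y \<and> line_vecs a b = line_vecs x y" for a b
    by blast
  show ?thesis
    unfolding all_lines_def line_lists_def
    by (simp only: set_append set_simps ball_Un ball_simps)
      (intro conjI line; simp add: lin_indep2_bit zero_vec4)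
qed

lemma pg_lines_bit: "(pg_lines :: (bit ^ 4) set set set) = (`) proj_point ` set all_lines"
proof (intro set_eqI iffI)
  fix L :: "(bit ^ 4) set set"
  assume "L \<in> pg_lines"
  then obtain x y where xy: "lin_indep2 x y" "L = proj_point ` line_vecs x y"
    unfolding pg_lines_def by (auto simp: line_through_bit)
  obtain V where V: "V \<in> set all_lines" "x \<in> V" "y \<in> V"
    using all_lines_cover[of x y] xy(1) by (auto simp: lin_indep2_bit)
  then obtain a b where "V = line_vecs a b"
    using all_lines_are_lines by meson
  then have "V = line_vecs x y"
    using line_vecs_eq[of x a b y] V(2,3) xy(1) by (simp add: lin_indep2_bit)
  then show "L \<in> (`) proj_point ` set all_lines"
    using V(1) xy(2) by blast
next
  fix L :: "(bit ^ 4) set set"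
  assume "L \<in> (`) proj_point ` set all_lines"
  then obtain V where V: "V \<in> set all_lines" "L = proj_point ` V"
    by blast
  then obtain a b where ab: "lin_indep2 a b" "V = line_vecs a b"
    using all_lines_are_lines by meson
  then have "L = line_through a b"
    using V(2) by (simp add: line_through_bit)
  then show "L \<in> pg_lines"
    unfolding pg_lines_def using ab(1) by blast
qed

lemma all_lines_pg_lines: "V \<in> set all_lines \<Longrightarrow> proj_point ` V \<in> pg_lines"
  by (simp add: pg_lines_bit)

lemma card_proj_point_lines:
  "distinct xs \<Longrightarrow> card ((`) proj_point ` set xs) = length (xs :: (bit ^ 4) set list)"
  by (simp add: card_image distinct_card inj_on_subset[OF inj_proj_point_image])

section \<open>The twisted cubic over GF(2)\<close>

lemma all_bit_option: "(\<forall>t :: bit option. P t) \<longleftrightarrow> P None \<and> P (Some 0) \<and> P (Some 1)"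
  by (metis bit_eq_0_or_1 option.exhaust)

lemma ex_bit_option: "(\<exists>t :: bit option. P t) \<longleftrightarrow> P None \<or> P (Some 0) \<or> P (Some 1)"
  by (metis bit_eq_0_or_1 option.exhaust)

lemma bit_numeral_3 [simp]: "(3 :: bit) = 1"
  by (simp only: numeral_Bit1 numeral_One one_add_one bit_2_eq_0 add_0)

definition cubic_vecs :: "(bit ^ 4) set" where
  "cubic_vecs = {vec4 1 0 0 0, vec4 0 0 0 1, vec4 1 1 1 1}"

text \<open>The third points of the real chords; together they form the imaginary axis.\<close>

definition chord_vecs :: "(bit ^ 4) set" where
  "chord_vecs = {vec4 1 0 0 1, vec4 0 1 1 1, vec4 1 1 1 0}"

text \<open>The point common to the three osculating planes.\<close>

definition osc_centre :: "bit ^ 4" where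
  "osc_centre = vec4 0 1 1 0"

definition plane_vecs :: "'a::field ^ 4 \<Rightarrow> ('a ^ 4) set" where
  "plane_vecs c = {x. x \<noteq> 0 \<and> dot4 c x = 0}"

definition osc_vecs :: "'a::field option \<Rightarrow> ('a ^ 4) set" where
  "osc_vecs t = plane_vecs (osc_coef t)"

lemma plane_eq_image: "plane c = proj_point ` plane_vecs c"
  by (auto simp: plane_def plane_vecs_def)

lemma plane_x1_x2_vecs: "plane_vecs (vec4 0 1 1 0) = insert osc_centre (cubic_vecs \<union> chord_vecs)"
  unfolding plane_vecs_def set_eq_iff all_bit4 all_bit
  by (simp add: osc_centre_def cubic_vecs_def chord_vecs_def zero_vec4)

lemma tcubic_bit: "(tcubic :: (bit ^ 4) set set) = proj_point ` cubic_vecs"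
  unfolding tcubic_def cubic_vecs_def by (auto simp: ex_bit_option)

lemma gamma_planes_bit:
  "(gamma_planes :: (bit ^ 4) set set set) = range (\<lambda>t. proj_point ` osc_vecs t)"
  by (auto simp: gamma_planes_def plane_eq_image osc_vecs_def)

lemma osc_vecs_explicit:
  "osc_vecs (None :: bit option) =
     {vec4 1 0 0 0, vec4 0 1 0 0, vec4 0 0 1 0,
      vec4 1 1 0 0, vec4 1 0 1 0, vec4 0 1 1 0, vec4 1 1 1 0}"
  "osc_vecs (Some (0 :: bit)) =
     {vec4 0 0 0 1, vec4 0 0 1 0, vec4 0 1 0 0, vec4 0 0 1 1,
      vec4 0 1 0 1, vec4 0 1 1 0, vec4 0 1 1 1}"
  "osc_vecs (Some (1 :: bit)) =
     {vec4 0 0 1 1, vec4 0 1 0 1, vec4 0 1 1 0, vec4 1 0 0 1,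
      vec4 1 0 1 0, vec4 1 1 0 0, vec4 1 1 1 1}"
  unfolding osc_vecs_def plane_vecs_def set_eq_iff all_bit4 all_bit by (simp_all add: zero_vec4)

lemma inj_osc_vecs: "inj (\<lambda>t :: bit option. osc_vecs t)"
  unfolding inj_def all_bit_option osc_vecs_explicit by (simp add: set_eq_subset)

lemma osc_vecs_Int:
  "osc_vecs None \<inter> osc_vecs (Some (0 :: bit)) = line_vecs (vec4 0 1 1 0) (vec4 0 1 0 0)"
  "osc_vecs None \<inter> osc_vecs (Some (1 :: bit)) = line_vecs (vec4 0 1 1 0) (vec4 1 1 0 0)"
  "osc_vecs (Some (0 :: bit)) \<inter> osc_vecs (Some (1 :: bit)) =
     line_vecs (vec4 0 1 1 0) (vec4 0 1 0 1)"
  "osc_vecs (Some (0 :: bit)) \<inter> osc_vecs None = line_vecs (vec4 0 1 1 0) (vec4 0 1 0 0)"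
  "osc_vecs (Some (1 :: bit)) \<inter> osc_vecs None = line_vecs (vec4 0 1 1 0) (vec4 1 1 0 0)"
  "osc_vecs (Some (1 :: bit)) \<inter> osc_vecs (Some (0 :: bit)) =
     line_vecs (vec4 0 1 1 0) (vec4 0 1 0 1)"
  by (simp_all add: osc_vecs_explicit line_vecs_def Int_insert_left insert_commute)

lemma tangent_bit:
  "tangent (None :: bit option) = proj_point ` line_vecs (vec4 1 0 0 0) (vec4 0 1 0 0)"
  "tangent (Some (0 :: bit)) = proj_point ` line_vecs (vec4 0 0 0 1) (vec4 0 0 1 0)"
  "tangent (Some (1 :: bit)) = proj_point ` line_vecs (vec4 1 1 1 1) (vec4 1 0 1 0)"
  by (simp_all add: line_through_bit lin_indep2_bit zero_vec4)

section \<open>The line types\<close>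

lemma is_RC_iff:
  fixes V :: "(bit ^ 4) set"
  shows "is_RC (proj_point ` V) \<longleftrightarrow>
     proj_point ` V \<in> pg_lines \<and> (\<exists>a\<in>cubic_vecs. \<exists>b\<in>cubic_vecs. a \<noteq> b \<and> a \<in> V \<and> b \<in> V)"
  unfolding is_RC_def tcubic_bit by simp

lemma is_Tr_iff:
  fixes V :: "(bit ^ 4) set"
  shows "is_Tr (proj_point ` V) \<longleftrightarrow> V \<in> set tangent_lines"
  unfolding is_Tr_def ex_bit_option tangent_bit tangent_lines_def by auto

lemma is_Tr_pg_lines: "is_Tr (L :: (bit ^ 4) set set) \<Longrightarrow> L \<in> pg_lines"
  unfolding is_Tr_def ex_bit_option tangent_bit
  by (auto intro: all_lines_pg_lines simp: all_lines_def tangent_lines_def)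

lemma is_RA_iff:
  fixes V :: "(bit ^ 4) set"
  shows "is_RA (proj_point ` V) \<longleftrightarrow> proj_point ` V \<in> pg_lines \<and>
     (\<exists>s t. osc_vecs s \<noteq> osc_vecs t \<and>
       V = osc_vecs s \<inter> osc_vecs t)"
  unfolding is_RA_def gamma_planes_bit by (auto simp: proj_point_image_Int)

lemma real_axes_iff:
  fixes V :: "(bit ^ 4) set"
  shows "(\<exists>s t. osc_vecs s \<noteq> osc_vecs t \<and>
       V = osc_vecs s \<inter> osc_vecs t) \<longleftrightarrow>
     V \<in> set real_axis_lines"
  unfolding inj_eq[OF inj_osc_vecs] ex_bit_option osc_vecs_Int real_axis_lines_def
  by auto

lemma unisecant_iff:
  fixes V :: "(bit ^ 4) set"
  shows "unisecant (proj_point ` V) \<longleftrightarrow> proj_point ` V \<in> pg_lines \<and> card (V \<inter> cubic_vecs) = 1"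
  unfolding unisecant_def tcubic_bit proj_point_image_Int
  by (simp add: card_image inj_on_subset[OF inj_proj_point_bit])

lemma external_line_iff:
  fixes V :: "(bit ^ 4) set"
  shows "external_line (proj_point ` V) \<longleftrightarrow> proj_point ` V \<in> pg_lines \<and> V \<inter> cubic_vecs = {}"
  unfolding external_line_def tcubic_bit proj_point_image_Int by simp

lemma in_gamma_plane_iff:
  fixes V :: "(bit ^ 4) set"
  shows "in_gamma_plane (proj_point ` V) \<longleftrightarrow> (\<exists>t. V \<subseteq> osc_vecs t)"
  unfolding in_gamma_plane_def gamma_planes_bit by auto

lemma is_EG_iff:
  fixes V :: "(bit ^ 4) set"
  shows "is_EG (proj_point ` V) \<longleftrightarrow> external_line (proj_point ` V) \<and> (\<exists>!t. V \<subseteq> osc_vecs t)"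
proof -
  have "{\<pi> \<in> gamma_planes. proj_point ` V \<subseteq> \<pi>} =
      (\<lambda>t. proj_point ` osc_vecs t) ` {t. V \<subseteq> osc_vecs t}"
    unfolding gamma_planes_bit by auto
  moreover have "inj (\<lambda>t :: bit option. proj_point ` osc_vecs t)"
    using inj_osc_vecs by (simp add: inj_def)
  ultimately have "card {\<pi> \<in> gamma_planes. proj_point ` V \<subseteq> \<pi>} = card {t. V \<subseteq> osc_vecs t}"
    by (simp add: card_image inj_on_subset)
  then show ?thesis
    unfolding is_EG_def by (simp add: card_1_singleton_iff Ex1_def set_eq_iff) blast
qed

lemma is_UG2_iff:
  fixes V :: "(bit ^ 4) set"
  shows "is_UG2 (proj_point ` V) \<longleftrightarrow> is_UG (proj_point ` V) \<and> V \<subseteq> plane_vecs (vec4 0 1 1 0)"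
  unfolding is_UG2_def plane_x1_x2_def plane_eq_image by simp

lemma is_UG1_iff:
  fixes V :: "(bit ^ 4) set"
  shows "is_UG1 (proj_point ` V) \<longleftrightarrow> is_UG (proj_point ` V) \<and> \<not> V \<subseteq> plane_vecs (vec4 0 1 1 0)"
  unfolding is_UG1_def plane_x1_x2_def plane_eq_image by simp

lemma ex_gf4: "(\<exists>a :: gf4. P a) \<longleftrightarrow> P G0 \<or> P G1 \<or> P GW \<or> P GW2"
  by (metis gf4.exhaust)

lemma gf4_arith:
  "(0 :: gf4) = G0" "(1 :: gf4) = G1" "(2 :: gf4) = G0" "(3 :: gf4) = G1"
  "a + b = gf4_add a b" "a * b = gf4_mul a b" "- a = a"
  "GW ^ 2 = GW2" "GW ^ 3 = G1" "GW2 ^ 2 = GW" "GW2 ^ 3 = G1"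
  by (simp_all add: zero_gf4_def one_gf4_def plus_gf4_def times_gf4_def uminus_gf4_def
      numeral_Bit0 numeral_Bit1 power2_eq_square power3_eq_cube)

lemma emb24_vec_vec4: "emb24_vec (vec4 a b c d) = vec4 (emb24 a) (emb24 b) (emb24 c) (emb24 d)"
  by (simp add: emb24_vec_def vec_eq_iff all_index_4)

lemma emb24_bit [simp]: "emb24 0 = G0" "emb24 1 = G1"
  by (simp_all add: emb24_def gf4_arith)

lemma not_in_range_emb24: "\<alpha> \<notin> range emb24 \<longleftrightarrow> \<alpha> = GW \<or> \<alpha> = GW2"
proof -
  have "range emb24 = {G0, G1}"
    using bit_eq_0_or_1 by (auto simp: emb24_def gf4_arith)
  then show ?thesis
    by (cases \<alpha>) auto
qed

lemma imag_chord_span: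
  assumes "\<alpha> \<notin> range emb24"
  shows "emb24_vec x \<in> span2 (tc_vec (Some \<alpha>)) (tc_vec (Some (\<alpha> ^ 2))) \<longleftrightarrow>
    x \<in> insert 0 (line_vecs (vec4 0 1 1 0) (vec4 1 1 0 1))"
  using assms unfolding not_in_range_emb24 span2_def line_vecs_def
  by (cases x rule: bit4_cases; elim disjE; simp add: ex_gf4 gf4_arith emb24_vec_vec4 zero_vec4)

lemma imag_axis_planes:
  assumes "\<alpha> \<notin> range emb24"
  shows "dot4 (osc_coef (Some \<alpha>)) (emb24_vec x) = 0 \<and>
      dot4 (osc_coef (Some (\<alpha> ^ 2))) (emb24_vec x) = 0 \<longleftrightarrow>
    x \<in> insert 0 chord_vecs"
  using assms unfolding not_in_range_emb24 chord_vecs_def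
  by (cases x rule: bit4_cases; elim disjE; simp add: gf4_arith emb24_vec_vec4 zero_vec4)

lemma bex_not_in_range_emb24_iff:
  assumes "\<And>\<alpha> x. \<alpha> \<notin> range emb24 \<Longrightarrow> Q \<alpha> x \<longleftrightarrow> x \<in> S"
  shows "(\<exists>\<alpha>. \<alpha> \<notin> range emb24 \<and> (\<forall>x\<in>V. Q \<alpha> x)) \<longleftrightarrow> V \<subseteq> S"
proof -
  have "GW \<notin> range emb24"
    by (simp add: not_in_range_emb24)
  then show ?thesis
    using assms by blast
qed

lemma is_IC2_iff:
  fixes V :: "(bit ^ 4) set"
  shows "is_IC2 (proj_point ` V) \<longleftrightarrow>
    proj_point ` V \<in> pg_lines \<and> V \<subseteq> insert 0 (line_vecs (vec4 0 1 1 0) (vec4 1 1 0 1))"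
  unfolding is_IC2_def ball_simps proj_point_bit
  using bex_not_in_range_emb24_iff[OF imag_chord_span] by simp

lemma is_IA2_iff:
  fixes V :: "(bit ^ 4) set"
  shows "is_IA2 (proj_point ` V) \<longleftrightarrow> proj_point ` V \<in> pg_lines \<and> V \<subseteq> insert 0 chord_vecs"
  unfolding is_IA2_def ball_simps proj_point_bit
  using bex_not_in_range_emb24_iff[OF imag_axis_planes] by simp

lemma line_type_eq_filter:
  fixes P :: "(bit ^ 4) set set \<Rightarrow> bool"
  assumes "\<And>L. P L \<Longrightarrow> L \<in> pg_lines"
    and "\<And>V. V \<in> set all_lines \<Longrightarrow> P (proj_point ` V) \<longleftrightarrow> Q V"
    and "filter Q all_lines = xs"
  shows "{L. P L} = (`) proj_point ` set xs"
proof -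
  have "{L. P L} = (`) proj_point ` {V \<in> set all_lines. P (proj_point ` V)}"
    using assms(1) unfolding pg_lines_bit by blast
  then show ?thesis
    using assms(2,3) by auto
qed

lemma real_chord_lines_eq: "{L. is_RC L} = (`) proj_point ` set real_chord_lines"
  by (rule line_type_eq_filter[where Q = "\<lambda>V. \<exists>a\<in>cubic_vecs. \<exists>b\<in>cubic_vecs. a \<noteq> b \<and> a \<in> V \<and> b \<in> V"])
    (simp add: is_RC_def, simp add: is_RC_iff all_lines_pg_lines,
     simp add: all_lines_def line_lists_def line_vecs_def cubic_vecs_def)

lemma imag_axis_lines_eq: "{L. is_IA2 L} = (`) proj_point ` set imag_axis_lines"
  by (rule line_type_eq_filter[where Q = "\<lambda>V. V \<subseteq> insert 0 chord_vecs"])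
    (simp add: is_IA2_def, simp add: is_IA2_iff all_lines_pg_lines,
     simp add: all_lines_def line_lists_def line_vecs_def chord_vecs_def zero_vec4)

lemma ug2_lines_eq: "{L. is_UG2 L} = (`) proj_point ` set ug2_lines"
  by (rule line_type_eq_filter[where Q = "\<lambda>V. card (V \<inter> cubic_vecs) = 1 \<and> V \<notin> set tangent_lines \<and>
      (\<exists>t. V \<subseteq> osc_vecs t) \<and> V \<subseteq> plane_vecs (vec4 0 1 1 0)"])
    (simp add: is_UG2_def is_UG_def unisecant_def,
     simp add: is_UG2_iff is_UG_def unisecant_iff is_Tr_iff in_gamma_plane_iff all_lines_pg_lines,
     simp add: all_lines_def line_lists_def line_vecs_def cubic_vecs_def ex_bit_option
       osc_vecs_explicit plane_vecs_def set_eq_subset zero_vec4)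

lemma real_axis_lines_eq: "{L. is_RA L} = (`) proj_point ` set real_axis_lines"
  by (rule line_type_eq_filter[where Q = "\<lambda>V. V \<in> set real_axis_lines"])
    (simp add: is_RA_def, simp add: is_RA_iff real_axes_iff all_lines_pg_lines,
     simp add: all_lines_def line_lists_def line_vecs_def set_eq_subset)

lemma imag_chord_lines_eq: "{L. is_IC2 L} = (`) proj_point ` set imag_chord_lines"
  by (rule line_type_eq_filter[where
        Q = "\<lambda>V. V \<subseteq> insert 0 (line_vecs (vec4 0 1 1 0) (vec4 1 1 0 1))"])
    (simp add: is_IC2_def, simp add: is_IC2_iff all_lines_pg_lines,
     simp add: all_lines_def line_lists_def line_vecs_def zero_vec4)

lemma tangent_lines_eq: "{L. is_Tr L} = (`) proj_point ` set tangent_lines"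
  by (rule line_type_eq_filter[where Q = "\<lambda>V. V \<in> set tangent_lines"])
    (erule is_Tr_pg_lines, rule is_Tr_iff,
     simp add: all_lines_def line_lists_def line_vecs_def set_eq_subset)

lemma ug1_lines_eq: "{L. is_UG1 L} = (`) proj_point ` set ug1_lines"
  by (rule line_type_eq_filter[where Q = "\<lambda>V. card (V \<inter> cubic_vecs) = 1 \<and> V \<notin> set tangent_lines \<and>
      (\<exists>t. V \<subseteq> osc_vecs t) \<and> \<not> V \<subseteq> plane_vecs (vec4 0 1 1 0)"])
    (simp add: is_UG1_def is_UG_def unisecant_def,
     simp add: is_UG1_iff is_UG_def unisecant_iff is_Tr_iff in_gamma_plane_iff all_lines_pg_lines,
     simp add: all_lines_def line_lists_def line_vecs_def cubic_vecs_def ex_bit_option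
       osc_vecs_explicit plane_vecs_def set_eq_subset zero_vec4)

lemma ung_lines_eq: "{L. is_UnG L} = (`) proj_point ` set ung_lines"
  by (rule line_type_eq_filter[where Q = "\<lambda>V. card (V \<inter> cubic_vecs) = 1 \<and> \<not> (\<exists>t. V \<subseteq> osc_vecs t)"])
    (simp add: is_UnG_def unisecant_def,
     simp add: is_UnG_def unisecant_iff in_gamma_plane_iff all_lines_pg_lines,
     simp add: all_lines_def line_lists_def line_vecs_def cubic_vecs_def ex_bit_option
       osc_vecs_explicit)

lemma eg_lines_eq: "{L. is_EG L} = (`) proj_point ` set eg_lines"
  by (rule line_type_eq_filter[where Q = "\<lambda>V. V \<inter> cubic_vecs = {} \<and> (\<exists>!t. V \<subseteq> osc_vecs t)"])
    (simp add: is_EG_def external_line_def,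
     simp add: is_EG_iff external_line_iff all_lines_pg_lines,
     simp add: all_lines_def line_lists_def line_vecs_def cubic_vecs_def Ex1_def ex_bit_option
       all_bit_option osc_vecs_explicit)

lemma eng_lines_eq: "{L. is_EnG2 L} = (`) proj_point ` set eng_lines"
  by (rule line_type_eq_filter[where Q = "\<lambda>V. V \<inter> cubic_vecs = {} \<and> \<not> (\<exists>t. V \<subseteq> osc_vecs t) \<and>
      \<not> V \<subseteq> insert 0 (line_vecs (vec4 0 1 1 0) (vec4 1 1 0 1)) \<and> \<not> V \<subseteq> insert 0 chord_vecs"])
    (simp add: is_EnG2_def external_line_def,
     simp add: is_EnG2_def external_line_iff in_gamma_plane_iff is_IC2_iff is_IA2_iff
       all_lines_pg_lines,
     simp add: all_lines_def line_lists_def line_vecs_def cubic_vecs_def chord_vecs_def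
       ex_bit_option osc_vecs_explicit zero_vec4)

lemma distinct_line_lists:
  "distinct real_chord_lines" "distinct imag_axis_lines" "distinct ug2_lines"
  "distinct real_axis_lines" "distinct imag_chord_lines" "distinct tangent_lines"
  "distinct ug1_lines" "distinct ung_lines" "distinct eg_lines" "distinct eng_lines"
  "distinct (real_axis_lines @ imag_chord_lines)"
  "distinct (tangent_lines @ ug1_lines @ ung_lines)" "distinct (eg_lines @ eng_lines)"
  using distinct_all_lines unfolding all_lines_def by auto

lemma card_line_types:
  "card ((`) proj_point ` set real_chord_lines) = 3"
  "card ((`) proj_point ` set imag_axis_lines) = 1"
  "card ((`) proj_point ` set ug2_lines) = 3"
  "card ((`) proj_point ` set real_axis_lines) = 3"
  "card ((`) proj_point ` set imag_chord_lines) = 1"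
  "card ((`) proj_point ` set tangent_lines) = 3"
  "card ((`) proj_point ` set ug1_lines) = 3"
  "card ((`) proj_point ` set ung_lines) = 6"
  "card ((`) proj_point ` set eg_lines) = 6"
  "card ((`) proj_point ` set eng_lines) = 6"
  "card ((`) proj_point ` set (real_axis_lines @ imag_chord_lines)) = 4"
  "card ((`) proj_point ` set (tangent_lines @ ug1_lines @ ung_lines)) = 12"
  "card ((`) proj_point ` set (eg_lines @ eng_lines)) = 12"
  by (simp_all only: card_proj_point_lines distinct_line_lists) (simp_all add: line_lists_def)

section \<open>The group G_2 and the profile of a line\<close>

lemma pmap_proj_point_image: "pmap A ` proj_point ` V = proj_point ` (*v) A ` (V :: (bit ^ 4) set)"
  by (simp add: image_image pmap_def proj_point_bit)

lemma lmap_proj_point_image: "lmap A (proj_point ` V) = proj_point ` (*v) A ` (V :: (bit ^ 4) set)"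
  by (simp add: lmap_def pmap_proj_point_image)

lemma Gq_bit: "A \<in> Gq \<longleftrightarrow> invertible A \<and> (*v) A ` cubic_vecs = (cubic_vecs :: (bit ^ 4) set)"
  unfolding Gq_def tcubic_bit pmap_proj_point_image by simp

lemma Gq_one: "mat 1 \<in> (Gq :: (bit ^ 4 ^ 4) set)"
  unfolding Gq_bit invertible_left_inverse by auto

lemma Gq_inj: "A \<in> Gq \<Longrightarrow> inj ((*v) (A :: bit ^ 4 ^ 4))"
  unfolding Gq_bit using invertible_left_inverse matrix_left_invertible_injective by blast

lemma Gq_mult: "A \<in> Gq \<Longrightarrow> B \<in> Gq \<Longrightarrow> A ** B \<in> (Gq :: (bit ^ 4 ^ 4) set)"
  unfolding Gq_bit by (simp add: invertible_mult image_matrix_mult)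

lemma Gq_inverse:
  assumes "A \<in> Gq"
  obtains B where "B \<in> Gq" "B ** A = (mat 1 :: bit ^ 4 ^ 4)"
proof -
  obtain B where AB: "A ** B = mat 1" "B ** A = mat 1"
    using assms unfolding Gq_bit invertible_def by blast
  then have "(*v) B ` cubic_vecs = (*v) B ` ((*v) A ` cubic_vecs)"
    using assms by (simp add: Gq_bit)
  also have "\<dots> = cubic_vecs"
    using AB(2) by (simp flip: image_matrix_mult)
  finally have "B \<in> Gq"
    unfolding Gq_bit invertible_def using AB by blast
  then show thesis
    using AB(2) that by blast
qed

lemma cubic_triangle:
  assumes "p \<in> cubic_vecs" "q \<in> cubic_vecs" "r \<in> cubic_vecs" "p \<noteq> q" "p \<noteq> r" "q \<noteq> r"
  shows "{p + q, p + r, q + r} = chord_vecs" "p + q + r = osc_centre"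
  using assms unfolding cubic_vecs_def
  by (elim insertE emptyE; simp add: chord_vecs_def osc_centre_def insert_commute)+

lemma Gq_chord_vecs_osc_centre:
  assumes "A \<in> Gq"
  shows "(*v) A ` chord_vecs = chord_vecs" "A *v osc_centre = osc_centre"
proof -
  define p q r where "p = A *v vec4 1 0 0 0" "q = A *v vec4 0 0 0 1" "r = A *v vec4 1 1 1 1"
  have "{p, q, r} = cubic_vecs"
    using assms unfolding Gq_bit p_q_r_def cubic_vecs_def by simp
  moreover have "p \<noteq> q" "p \<noteq> r" "q \<noteq> r"
    using Gq_inj[OF assms] unfolding p_q_r_def by (simp_all add: inj_eq)
  ultimately have triangle: "{p + q, p + r, q + r} = chord_vecs" "p + q + r = osc_centre"
    using cubic_triangle[of p q r] by auto
  have "(*v) A ` chord_vecs = {p + q, p + r, q + r}"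
    unfolding chord_vecs_def p_q_r_def
    by (simp add: insert_commute flip: matrix_vector_right_distrib)
  then show "(*v) A ` chord_vecs = chord_vecs"
    using triangle(1) by simp
  have "A *v osc_centre = p + q + r"
    unfolding osc_centre_def p_q_r_def by (simp flip: matrix_vector_right_distrib)
  then show "A *v osc_centre = osc_centre"
    using triangle(2) by simp
qed

lemma Gq_dot4_plane_x1_x2:
  fixes A :: "bit ^ 4 ^ 4"
  assumes "A \<in> Gq"
  shows "dot4 (vec4 0 1 1 0) (A *v x) = dot4 (vec4 0 1 1 0) x"
proof -
  have "(*v) A ` plane_vecs (vec4 0 1 1 0) = plane_vecs (vec4 0 1 1 0)"
    using assms Gq_chord_vecs_osc_centre[OF assms] unfolding plane_x1_x2_vecs Gq_bit
    by (simp add: image_Un)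
  then have "A *v x \<in> plane_vecs (vec4 0 1 1 0) \<longleftrightarrow> x \<in> plane_vecs (vec4 0 1 1 0)"
    using inj_image_mem_iff[OF Gq_inj[OF assms]] by metis
  moreover have "A *v x = 0 \<longleftrightarrow> x = 0"
    using Gq_inj[OF assms] by (metis injD matrix_vector_mult_0_right)
  ultimately show ?thesis
    unfolding plane_vecs_def by (cases "x = 0") (auto simp: bit_not_zero_iff)
qed

definition cubic_profile :: "(bit ^ 4) set \<Rightarrow> nat \<times> nat \<times> bool" where
  "cubic_profile V = (card (V \<inter> cubic_vecs), card (V \<inter> chord_vecs), osc_centre \<in> V)"

lemma card_image_Int_invariant:
  assumes "inj f" "f ` T = T"
  shows "card (f ` V \<inter> T) = card (V \<inter> T)"
proof -
  have "f ` V \<inter> T = f ` (V \<inter> T)"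
    using assms by (metis image_Int)
  then show ?thesis
    using assms(1) by (simp add: card_image inj_on_subset)
qed

lemma Gq_cubic_profile:
  assumes "A \<in> Gq"
  shows "cubic_profile ((*v) A ` V) = cubic_profile V"
proof -
  have "osc_centre \<in> (*v) A ` V \<longleftrightarrow> A *v osc_centre \<in> (*v) A ` V"
    using Gq_chord_vecs_osc_centre(2)[OF assms] by simp
  also have "\<dots> \<longleftrightarrow> osc_centre \<in> V"
    by (rule inj_image_mem_iff[OF Gq_inj[OF assms]])
  finally show ?thesis
    using assms unfolding cubic_profile_def Gq_bit
    by (simp add: card_image_Int_invariant[OF Gq_inj[OF assms]]
        Gq_chord_vecs_osc_centre(1)[OF assms])
qed

lemma Gq_image_all_lines:
  assumes "A \<in> Gq" "V \<in> set all_lines"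
  shows "(*v) A ` V \<in> set all_lines"
proof -
  obtain a b where ab: "lin_indep2 a b" "V = line_vecs a b"
    using all_lines_are_lines assms(2) by meson
  then have indep: "lin_indep2 (A *v a) (A *v b)"
    using Gq_inj[OF assms(1)] unfolding lin_indep2_bit by (metis injD matrix_vector_mult_0_right)
  then have "proj_point ` (*v) A ` V = line_through (A *v a) (A *v b)"
    unfolding ab(2) image_line_vecs by (simp add: line_through_bit)
  then have "proj_point ` (*v) A ` V \<in> pg_lines"
    unfolding pg_lines_def using indep by blast
  then show ?thesis
    unfolding pg_lines_bit by auto
qed

section \<open>Transitivity on lines of equal profile\<close>

definition transvection :: "'a::comm_ring_1 ^ 4 \<Rightarrow> 'a ^ 4 \<Rightarrow> 'a ^ 4 ^ 4" where
  "transvection w t = (\<chi> i j. of_bool (i = j) + t $ i * w $ j)"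

lemma transvection_apply: "transvection w t *v x = x + dot4 w x *s t"
  by (simp add: transvection_def matrix_vector_mult_def dot4_def vec_eq_iff all_index_4 sum_UNIV_4
      algebra_simps)

lemma transvection_inverse: "dot4 w t = 0 \<Longrightarrow> transvection w (- t) ** transvection w t = mat 1"
  unfolding matrix_eq
  by (simp add: transvection_apply dot4_add dot4_scalar_mult vec_eq_iff algebra_simps
      flip: matrix_vector_mul_assoc)

lemma transvection_Gq:
  fixes t :: "bit ^ 4"
  assumes "dot4 (vec4 0 1 1 0) t = 0"
  shows "transvection (vec4 0 1 1 0) t \<in> Gq"
proof -
  have "invertible (transvection (vec4 0 1 1 0) t)"
    using transvection_inverse[OF assms] invertible_left_inverse by blast
  then show ?thesis
    unfolding Gq_bit by (simp add: transvection_apply cubic_vecs_def)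
qed

lemma transvection_line_vecs:
  fixes p v u :: "bit ^ 4"
  assumes "dot4 w p = 0" "dot4 w v = 1" "dot4 w u = 1"
  shows "(*v) (transvection w (v + u)) ` line_vecs p v = line_vecs p u"
  using assms unfolding image_line_vecs by (simp add: transvection_apply flip: add.assoc)

text \<open>Induced by t \<mapsto> 1/t: it swaps P(0) and P(\<infinity>) and fixes P(1).\<close>

definition cubic_inversion :: "bit ^ 4 ^ 4" where
  "cubic_inversion = vec4 (vec4 0 0 0 1) (vec4 0 0 1 0) (vec4 0 1 0 0) (vec4 1 0 0 0)"

text \<open>Induced by t \<mapsto> t + 1, as (t + 1)^3 = t^3 + t^2 + t + 1 over GF(2).\<close>

definition cubic_translation :: "bit ^ 4 ^ 4" where
  "cubic_translation = vec4 (vec4 1 1 1 1) (vec4 0 1 0 1) (vec4 0 0 1 1) (vec4 0 0 0 1)"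

lemma cubic_inversion_Gq: "cubic_inversion \<in> Gq"
  unfolding Gq_bit invertible_left_inverse
  by (auto intro!: exI[of _ cubic_inversion] simp: cubic_inversion_def cubic_vecs_def
      vec4_matrix_mult vec4_vector_matrix_mult mat_1_vec4 insert_commute)

lemma cubic_translation_Gq: "cubic_translation \<in> Gq"
  unfolding Gq_bit invertible_left_inverse
  by (auto intro!: exI[of _ cubic_translation] simp: cubic_translation_def cubic_vecs_def
      vec4_matrix_mult vec4_vector_matrix_mult mat_1_vec4 insert_commute)

text \<open>
  The chord point opposite a point p of the cubic is p + c; for P(\<infinity>) it is (1, 1, 1, 0).
\<close>

lemma Gq_transitive_cubic_chord:
  assumes "p \<in> cubic_vecs"
  shows "\<exists>A\<in>Gq. A *v vec4 1 0 0 0 = p \<and> A *v vec4 1 1 1 0 = p + osc_centre"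
proof -
  consider "p = vec4 1 0 0 0" | "p = vec4 0 0 0 1" | "p = vec4 1 1 1 1"
    using assms unfolding cubic_vecs_def by blast
  then show ?thesis
  proof cases
    case 1
    then show ?thesis
      using Gq_one by (intro bexI[of _ "mat 1"]) (simp_all add: osc_centre_def)
  next
    case 2
    then show ?thesis
      using cubic_inversion_Gq
      by (intro bexI[of _ cubic_inversion]) (simp_all add: cubic_inversion_def osc_centre_def)
  next
    case 3
    then show ?thesis
      using Gq_mult[OF cubic_translation_Gq cubic_inversion_Gq]
      by (intro bexI[of _ "cubic_translation ** cubic_inversion"])
        (simp_all add: cubic_inversion_def cubic_translation_def osc_centre_def
          flip: matrix_vector_mul_assoc)
  qed
qed

lemma outside_line_reachable:
  fixes p v u :: "bit ^ 4"
  assumes "A \<in> Gq" "dot4 (vec4 0 1 1 0) p = 0"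
    and "dot4 (vec4 0 1 1 0) v = 1" "dot4 (vec4 0 1 1 0) u = 1"
  shows "\<exists>B\<in>Gq. (*v) B ` line_vecs p v = line_vecs (A *v p) u"
proof -
  let ?w = "vec4 0 1 1 0 :: bit ^ 4"
  let ?T = "transvection ?w (A *v v + u)"
  have Ap: "dot4 ?w (A *v p) = 0" and Av: "dot4 ?w (A *v v) = 1"
    using assms Gq_dot4_plane_x1_x2 by simp_all
  then have "?T \<in> Gq"
    using assms(4) by (intro transvection_Gq) (simp add: dot4_add)
  moreover have "(*v) (?T ** A) ` line_vecs p v = (*v) ?T ` line_vecs (A *v p) (A *v v)"
    by (simp only: image_matrix_mult image_line_vecs matrix_vector_mul_assoc)
  moreover have "\<dots> = line_vecs (A *v p) u"
    using Ap Av assms(4) by (rule transvection_line_vecs)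
  ultimately show ?thesis
    using Gq_mult[OF _ assms(1)] by metis
qed

lemma real_chord_lines_reachable:
  "\<forall>W\<in>set real_chord_lines. \<exists>A\<in>Gq. (*v) A ` line_vecs (vec4 1 0 0 0) (vec4 0 0 0 1) = W"
proof -
  have "cubic_inversion ** cubic_translation \<in> Gq"
    using Gq_mult cubic_inversion_Gq cubic_translation_Gq by blast
  then show ?thesis
    using Gq_one cubic_translation_Gq unfolding real_chord_lines_def image_line_vecs
    by (simp, intro conjI bexI[of _ "mat 1"] bexI[of _ cubic_translation]
        bexI[of _ "cubic_inversion ** cubic_translation"])
      (simp_all add: cubic_inversion_def cubic_translation_def flip: matrix_vector_mul_assoc)
qed

lemma imag_axis_lines_reachable:
  "\<forall>W\<in>set imag_axis_lines. \<exists>A\<in>Gq. (*v) A ` line_vecs (vec4 1 0 0 1) (vec4 0 1 1 1) = W"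
  using Gq_one unfolding imag_axis_lines_def by force

lemma ug2_lines_reachable:
  "\<forall>W\<in>set ug2_lines. \<exists>A\<in>Gq. (*v) A ` line_vecs (vec4 1 0 0 0) (vec4 0 1 1 0) = W"
proof -
  have reach: "\<exists>A\<in>Gq. (*v) A ` line_vecs (vec4 1 0 0 0) (vec4 0 1 1 0) = line_vecs p (vec4 0 1 1 0)"
    if "p \<in> cubic_vecs" for p
    using Gq_transitive_cubic_chord[OF that] Gq_chord_vecs_osc_centre(2)
    unfolding image_line_vecs osc_centre_def by metis
  show ?thesis
    unfolding ug2_lines_def by (simp add: reach cubic_vecs_def)
qed

lemma centre_lines_reachable:
  "\<forall>W\<in>set (real_axis_lines @ imag_chord_lines).
     \<exists>A\<in>Gq. (*v) A ` line_vecs (vec4 0 1 1 0) (vec4 0 1 0 0) = W"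
proof -
  have reach: "\<exists>A\<in>Gq. (*v) A ` line_vecs (vec4 0 1 1 0) (vec4 0 1 0 0) = line_vecs (vec4 0 1 1 0) v"
    if "dot4 (vec4 0 1 1 0) v = 1" for v :: "bit ^ 4"
    using outside_line_reachable[OF Gq_one, of "vec4 0 1 1 0" "vec4 0 1 0 0" v] that by simp
  show ?thesis
    unfolding real_axis_lines_def imag_chord_lines_def by (simp add: reach)
qed

lemma cubic_point_lines_reachable:
  "\<forall>W\<in>set (tangent_lines @ ug1_lines @ ung_lines).
     \<exists>A\<in>Gq. (*v) A ` line_vecs (vec4 1 0 0 0) (vec4 0 1 0 0) = W"
proof -
  have reach: "\<exists>A\<in>Gq. (*v) A ` line_vecs (vec4 1 0 0 0) (vec4 0 1 0 0) = line_vecs p v"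
    if "p \<in> cubic_vecs" "dot4 (vec4 0 1 1 0) v = 1" for p v
    using Gq_transitive_cubic_chord[OF that(1)] outside_line_reachable[of _ _ _ v] that(2)
    by fastforce
  show ?thesis
    unfolding tangent_lines_def ug1_lines_def ung_lines_def by (simp add: reach cubic_vecs_def)
qed

lemma chord_point_lines_reachable:
  "\<forall>W\<in>set (eg_lines @ eng_lines).
     \<exists>A\<in>Gq. (*v) A ` line_vecs (vec4 1 1 1 0) (vec4 0 1 0 0) = W"
proof -
  have reach: "\<exists>A\<in>Gq. (*v) A ` line_vecs (vec4 1 1 1 0) (vec4 0 1 0 0) = line_vecs d v"
    if "d \<in> chord_vecs" "dot4 (vec4 0 1 1 0) v = 1" for d v
  proof -
    have "d + osc_centre \<in> cubic_vecs"
      using that(1) by (auto simp: chord_vecs_def cubic_vecs_def osc_centre_def)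
    then obtain A where A: "A \<in> Gq" "A *v vec4 1 1 1 0 = d"
      using Gq_transitive_cubic_chord by (force simp: add.assoc)
    show ?thesis
      using outside_line_reachable[OF A(1), of "vec4 1 1 1 0" "vec4 0 1 0 0" v] that(2) A(2) by simp
  qed
  show ?thesis
    unfolding eg_lines_def eng_lines_def by (simp add: reach chord_vecs_def)
qed

section \<open>The line orbits\<close>

lemma line_orbit_subset:
  fixes S :: "(bit ^ 4) set set"
  assumes "\<forall>A\<in>Gq. \<forall>W\<in>S. (*v) A ` W \<in> S" "V \<in> S"
  shows "line_orbit (proj_point ` V) \<subseteq> (`) proj_point ` S"
  using assms unfolding line_orbit_def by (auto simp: lmap_proj_point_image)

lemma line_orbit_supset:
  fixes S :: "(bit ^ 4) set set"
  assumes reach: "\<forall>W\<in>S. \<exists>A\<in>Gq. (*v) A ` R = W" and V: "V \<in> S"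
  shows "(`) proj_point ` S \<subseteq> line_orbit (proj_point ` V)"
proof
  fix L
  assume "L \<in> (`) proj_point ` S"
  then obtain W where W: "W \<in> S" "L = proj_point ` W"
    by blast
  obtain A B where AB: "A \<in> Gq" "(*v) A ` R = W" "B \<in> Gq" "(*v) B ` R = V"
    using reach W(1) V by meson
  obtain C where C: "C \<in> Gq" "C ** B = mat 1"
    using Gq_inverse[OF AB(3)] by blast
  have "(*v) C ` V = R"
    unfolding AB(4)[symmetric] image_matrix_mult[symmetric] C(2) by simp
  then have "(*v) (A ** C) ` V = W"
    using AB(2) by (simp add: image_matrix_mult)
  then have "L = lmap (A ** C) (proj_point ` V)"
    using W(2) by (simp add: lmap_proj_point_image)
  then show "L \<in> line_orbit (proj_point ` V)"
    unfolding line_orbit_def using Gq_mult[OF AB(1) C(1)] by blast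
qed

lemma line_orbit_eq:
  assumes fibre: "filter (\<lambda>W. cubic_profile W = k) all_lines = xs"
    and reach: "\<forall>W\<in>set xs. \<exists>A\<in>Gq. (*v) A ` R = W"
    and V: "V \<in> set xs"
  shows "line_orbit (proj_point ` V) =
    (`) proj_point ` {W \<in> set all_lines. cubic_profile W = cubic_profile V}"
proof -
  have fibre_V: "{W \<in> set all_lines. cubic_profile W = cubic_profile V} = set xs"
    using V fibre by auto
  have "\<forall>A\<in>Gq. \<forall>W\<in>set xs. (*v) A ` W \<in> set xs"
    using fibre Gq_image_all_lines Gq_cubic_profile by auto
  then show ?thesis
    unfolding fibre_V using V reach by (intro equalityI line_orbit_subset line_orbit_supset)
qed

lemma cubic_profile_fibres:
  "filter (\<lambda>W. cubic_profile W = (2, 1, False)) all_lines = real_chord_lines"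
  "filter (\<lambda>W. cubic_profile W = (0, 3, False)) all_lines = imag_axis_lines"
  "filter (\<lambda>W. cubic_profile W = (1, 1, True)) all_lines = ug2_lines"
  "filter (\<lambda>W. cubic_profile W = (0, 0, True)) all_lines = real_axis_lines @ imag_chord_lines"
  "filter (\<lambda>W. cubic_profile W = (1, 0, False)) all_lines = tangent_lines @ ug1_lines @ ung_lines"
  "filter (\<lambda>W. cubic_profile W = (0, 1, False)) all_lines = eg_lines @ eng_lines"
  by (simp_all add: all_lines_def line_lists_def line_vecs_def cubic_profile_def cubic_vecs_def
      chord_vecs_def osc_centre_def Int_insert_left card_insert_if)

lemma line_orbit_fibre:
  assumes "V \<in> set all_lines"
  shows "line_orbit (proj_point ` V) =
    (`) proj_point ` {W \<in> set all_lines. cubic_profile W = cubic_profile V}"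
proof -
  have "V \<in> set real_chord_lines \<or> V \<in> set imag_axis_lines \<or> V \<in> set ug2_lines \<or>
      V \<in> set (real_axis_lines @ imag_chord_lines) \<or>
      V \<in> set (tangent_lines @ ug1_lines @ ung_lines) \<or>
      V \<in> set (eg_lines @ eng_lines)"
    using assms unfolding all_lines_def by auto
  then show ?thesis
    by (elim disjE)
      (simp_all only: line_orbit_eq[OF cubic_profile_fibres(1) real_chord_lines_reachable]
        line_orbit_eq[OF cubic_profile_fibres(2) imag_axis_lines_reachable]
        line_orbit_eq[OF cubic_profile_fibres(3) ug2_lines_reachable]
        line_orbit_eq[OF cubic_profile_fibres(4) centre_lines_reachable]
        line_orbit_eq[OF cubic_profile_fibres(5) cubic_point_lines_reachable]
        line_orbit_eq[OF cubic_profile_fibres(6) chord_point_lines_reachable])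
qed

lemma cubic_profile_values:
  "cubic_profile ` set all_lines =
    {(2, 1, False), (0, 3, False), (1, 1, True), (0, 0, True), (1, 0, False), (0, 1, False)}"
  by (simp add: all_lines_def line_lists_def line_vecs_def cubic_profile_def cubic_vecs_def
      chord_vecs_def osc_centre_def Int_insert_left card_insert_if insert_commute
      numeral_2_eq_2 numeral_3_eq_3)

lemma line_orbits_eq_fibres:
  "(line_orbits :: (bit ^ 4) set set set set) =
    (\<lambda>k. (`) proj_point ` {W \<in> set all_lines. cubic_profile W = k}) ` cubic_profile ` set all_lines"
  unfolding line_orbits_def pg_lines_bit image_image by (rule image_cong[OF refl line_orbit_fibre])

lemma card_line_orbits: "card (line_orbits :: (bit ^ 4) set set set set) = 6"
proof -
  have "inj_on (\<lambda>k. (`) proj_point ` {W \<in> set all_lines. cubic_profile W = k})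
      (cubic_profile ` set all_lines)"
  proof (rule inj_onI)
    fix k k'
    assume "k \<in> cubic_profile ` set all_lines"
    then obtain V where V: "V \<in> set all_lines" "cubic_profile V = k"
      by blast
    assume "(`) proj_point ` {W \<in> set all_lines. cubic_profile W = k} =
      (`) proj_point ` {W \<in> set all_lines. cubic_profile W = k'}"
    then have "{W \<in> set all_lines. cubic_profile W = k} = {W \<in> set all_lines. cubic_profile W = k'}"
      by (simp only: inj_image_eq_iff[OF inj_proj_point_image])
    then show "k = k'"
      using V by blast
  qed
  then show ?thesis
    unfolding line_orbits_eq_fibres by (simp add: card_image cubic_profile_values)
qed

lemma line_orbits_bit:
  "(line_orbits :: (bit ^ 4) set set set set) =
    {(`) proj_point ` set real_chord_lines, (`) proj_point ` set imag_axis_lines,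
     (`) proj_point ` set ug2_lines, (`) proj_point ` set (real_axis_lines @ imag_chord_lines),
     (`) proj_point ` set (tangent_lines @ ug1_lines @ ung_lines),
     (`) proj_point ` set (eg_lines @ eng_lines)}"
  unfolding line_orbits_eq_fibres cubic_profile_values image_insert image_empty
    set_filter[symmetric] cubic_profile_fibres ..

theorem theorem4p4:
  defines "L1 \<equiv> {L :: (bit ^ 4) set set. is_RC L}"
      and "L2 \<equiv> {L :: (bit ^ 4) set set. is_IA2 L}"
      and "L3 \<equiv> {L :: (bit ^ 4) set set. is_UG2 L}"
      and "RA \<equiv> {L :: (bit ^ 4) set set. is_RA L}"
      and "IC \<equiv> {L :: (bit ^ 4) set set. is_IC2 L}"
      and "Tr \<equiv> {L :: (bit ^ 4) set set. is_Tr L}"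
      and "UG1 \<equiv> {L :: (bit ^ 4) set set. is_UG1 L}"
      and "UnG \<equiv> {L :: (bit ^ 4) set set. is_UnG L}"
      and "EG \<equiv> {L :: (bit ^ 4) set set. is_EG L}"
      and "EnG \<equiv> {L :: (bit ^ 4) set set. is_EnG2 L}"
  shows "(line_orbits :: (bit ^ 4) set set set set) =
           {L1, L2, L3, RA \<union> IC, Tr \<union> UG1 \<union> UnG, EG \<union> EnG}
       \<and> card (line_orbits :: (bit ^ 4) set set set set) = 6
       \<and> card L1 = 3 \<and> card L2 = 1 \<and> card L3 = 3
       \<and> card RA = 3 \<and> card IC = 1 \<and> card (RA \<union> IC) = 4
       \<and> card Tr = 3 \<and> card UG1 = 3 \<and> card UnG = 6 \<and> card (Tr \<union> UG1 \<union> UnG) = 12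
       \<and> card EG = 6 \<and> card EnG = 6 \<and> card (EG \<union> EnG) = 12"
proof -
  have classes:
    "L1 = (`) proj_point ` set real_chord_lines" "L2 = (`) proj_point ` set imag_axis_lines"
    "L3 = (`) proj_point ` set ug2_lines" "RA = (`) proj_point ` set real_axis_lines"
    "IC = (`) proj_point ` set imag_chord_lines" "Tr = (`) proj_point ` set tangent_lines"
    "UG1 = (`) proj_point ` set ug1_lines" "UnG = (`) proj_point ` set ung_lines"
    "EG = (`) proj_point ` set eg_lines" "EnG = (`) proj_point ` set eng_lines"
    unfolding assms by (fact real_chord_lines_eq imag_axis_lines_eq ug2_lines_eq real_axis_lines_eq
        imag_chord_lines_eq tangent_lines_eq ug1_lines_eq ung_lines_eq eg_lines_eq eng_lines_eq)+
  have unions: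
    "RA \<union> IC = (`) proj_point ` set (real_axis_lines @ imag_chord_lines)"
    "Tr \<union> UG1 \<union> UnG = (`) proj_point ` set (tangent_lines @ ug1_lines @ ung_lines)"
    "EG \<union> EnG = (`) proj_point ` set (eg_lines @ eng_lines)"
    unfolding classes by (simp_all add: image_Un Un_assoc)
  show ?thesis
    unfolding unions unfolding classes
    using line_orbits_bit card_line_orbits card_line_types by (simp del: set_append)
qed

end
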